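(* Let $\alpha\in(0,1)$, let $\varphi:\Theta\to\mathbb R^{d_\varphi}$, and let $$CS_n=\Big\{\varphi^*\in\mathbb R^{d_\varphi}:S_n(\varphi^* )\le\frac1\alpha\Big\},$$ where $S_n(\varphi^* )$ is the cross-fit likelihood-ratio statistic defined in the context for the null parameter set $\Theta_0(\varphi^* )=\{\theta\in\Theta:\varphi(\theta)=\varphi^*\}$. Let $$\mathcal F^n=\big\{(\varphi^*,P^n):\varphi(\theta)=\varphi^*,\ P^n\in\mathcal P^n_\theta\ \text{for some }\theta\in\Theta\big\}.$$ Suppose that (i) $(Y_i,X_i,U_i)$, $i=1,\dots,n$, are independently distributed across $i$, and (ii) $(X_i,U_i)$, $i=1,\dots,n$, are identically distributed (the laws of the $Y_i$ may differ across $i$). Then, for any $n\in\mathbb N$, $$\inf_{(\varphi^*,P^n)\in\mathcal F^n}P^n\big(\varphi^*\in CS_n\big)\ge1-\alpha .$$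
   Context: **Model.** $\mathcal Y\subseteq\mathbb R^{d_Y}$ is a finite set, $\mathcal X\subseteq\mathbb R^{d_X}$, $\mathcal U\subseteq\mathbb R^{d_U}$, $\mathcal Z=\mathcal Y\times\mathcal X$, and $\Theta$ is an arbitrary (unrestricted) parameter set. $Y\in\mathcal Y$ and $X\in\mathcal X$ are observed, and $U\in\mathcal U$ is latent. For each $\theta\in\Theta$, $F_\theta(\cdot|x)$ is a conditional distribution of $U$ given $X=x$, and $G(\cdot|\cdot;\theta):\mathcal U\times\mathcal X\twoheadrightarrow\mathcal Y$ is a weakly measurable (nonempty-valued) correspondence. The model asserts only $Y\in G(U|X;\theta)$ a.s. For $A\subseteq\mathcal Y$ define the containment functional $$\nu_\theta(A|x)=\int 1\{G(u|x;\theta)\subseteq A\}\,dF_\theta(u|x).$$ Let $\mathcal P_{\theta,x}$ be the set of probability distributions $Q(\cdot|x)$ on $\mathcal Y$ with $Q(A|x)\ge\nu_\theta(A|x)$ for all $A\subseteq\mathcal Y$, and let $\mathfrak q_{\theta,x}$ be the set of probability mass functions on $\mathcal Y$ of the elements of $\mathcal P_{\theta,x}$. **Data-generating processes.** $\Delta(\mathcal Z^n)$ is the set of Borel probability measures on $\mathcal Z^n$. For $\theta\in\Theta$, $$\mathcal P^n_\theta=\Big\{P^n\in\Delta(\mathcal Z^n):P^n=\bigotimes_{i=1}^nP_i,\ P_i(\cdot|x)\in\mathcal P_{\theta,x}\ \ \forall i,\ \forall x\in\mathcal X\Big\},$$ where $P_i(\cdot|x)$ is the conditional law of $Y_i$ given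 $X_i=x$ under $P_i$. **Test statistic.** Fix $\varphi^*$ and write $\Theta_0=\Theta_0(\varphi^* )$. The statistic is only needed for $\varphi^*$ in the range of $\varphi$, so that $\Theta_0\neq\emptyset$. The sample is $(Y_i,X_i)$, $i=1,\dots,n$. The index set $\{1,\dots,n\}$ is split, without reference to the data, into two disjoint subsets $D_0,D_1$ with union $\{1,\dots,n\}$. 1. $\hat\theta_1$ is any $\Theta$-valued estimator computed from the observations in $D_1$ only. For each $x$, $p(\cdot|x)\in\mathfrak q_{\hat\theta_1,x}$ is any selected element with $p(y|x)>0$ for all $y\in\mathcal Y$ (a function of the $D_1$ data only). 2. For each $\theta\in\Theta_0$ and $x\in\mathcal X$, the LFP-based density is $$q_\theta(\cdot|x)=\operatorname*{arg\,min}_{q(\cdot|x)\in\mathfrak q_{\theta,x}}\ \sum_{y\in\mathcal Y}\ln\Big(\frac{q(y|x)+p(y|x)}{q(y|x)}\Big)\big(q(y|x)+p(y|x)\big).$$ 3. $\mathcal L_0(\theta)=\prod_{i\in D_0}q_\theta(Y_i|X_i)$ for $\theta\in\Theta_0$, $\mathcal L_0(\hat\theta_1)=\prod_{i\in D_0}p(Y_i|X_i)$, and $\hat\theta_0\in\operatorname*{arg\,max}_{\theta\in\Theta_0}\mathcal L_0(\theta)$. 4. $T_n(\varphi^* )=\mathcal L_0(\hat\theta_1)/\mathcal L_0(\hat\theta_0)$. $T_n^{\rm swap}(\varphi^* )$ is computed in the same way with the roles of $D_0$ and $D_1$ exchanged. $S_n(\varphi^* )=(T_n(\varphi^* )+T_n^{\rm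 swap}(\varphi^* ))/2$. **Conventions.** The objects in the construction are understood to be well defined: the estimators, the selection $p$ and the map $q_\theta$ are suitably measurable, a strictly positive $p(\cdot|x)$ exists, the $\arg\min$ is a uniquely determined minimizer, and the $\arg\max$ is attained. *)

theory Defs
  imports "HOL-Probability.Probability"
begin

abbreviation borel_on :: "'a::topological_space set \<Rightarrow> 'a measure" where
  "borel_on S \<equiv> restrict_space borel S"


section \<open>Incomplete discrete choice model\<close>

record ('th, 'y, 'x, 'u) model =
  outcomes :: "'y set"
  covariates :: "'x set"
  latents :: "'u set"
  params :: "'th set"
  latent_law :: "'th \<Rightarrow> 'x \<Rightarrow> 'u measure"
  prediction :: "'th \<Rightarrow> 'u \<Rightarrow> 'x \<Rightarrow> 'y set"

text \<open>Weak measurability of a correspondence: the lower inverse of every open set is measurable.\<close>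

definition valid_model ::
  "('th, 'y::euclidean_space, 'x::euclidean_space, 'u::euclidean_space) model \<Rightarrow> bool" where
  "valid_model m \<longleftrightarrow>
     finite (outcomes m) \<and>
     (\<forall>\<theta>\<in>params m.
        latent_law m \<theta> \<in> borel_on (covariates m) \<rightarrow>\<^sub>M prob_algebra (borel_on (latents m)) \<and>
        (\<forall>u\<in>latents m. \<forall>x\<in>covariates m.
           prediction m \<theta> u x \<noteq> {} \<and> prediction m \<theta> u x \<subseteq> outcomes m) \<and>
        (\<forall>V. open V \<longrightarrow>
           {(u, x) \<in> latents m \<times> covariates m. prediction m \<theta> u x \<inter> V \<noteq> {}}
             \<in> sets (borel_on (latents m \<times> covariates m))))"

definition containment ::
  "('th, 'y, 'x, 'u) model \<Rightarrow> 'th \<Rightarrow> 'x \<Rightarrow> 'y set \<Rightarrow> real" where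
  "containment m \<theta> x A = (\<integral>u. of_bool (prediction m \<theta> u x \<subseteq> A) \<partial>latent_law m \<theta> x)"

definition core_dists ::
  "('th, 'y::euclidean_space, 'x, 'u) model \<Rightarrow> 'th \<Rightarrow> 'x \<Rightarrow> 'y measure set" where
  "core_dists m \<theta> x =
     {Q. prob_space Q \<and> sets Q = sets (borel_on (outcomes m)) \<and>
         (\<forall>A\<subseteq>outcomes m. containment m \<theta> x A \<le> measure Q A)}"

text \<open>
  Mass functions vanish outside the outcome set, since \<open>measure Q {y} = 0\<close> when
  \<open>{y}\<close> is not in \<open>sets Q\<close>; hence they are determined by their values on outcomes.
\<close>

definition core_pmfs ::
  "('th, 'y::euclidean_space, 'x, 'u) model \<Rightarrow> 'th \<Rightarrow> 'x \<Rightarrow> ('y \<Rightarrow> real) set" where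
  "core_pmfs m \<theta> x = (\<lambda>Q y. measure Q {y}) ` core_dists m \<theta> x"


section \<open>Data-generating processes\<close>

definition obs_space ::
  "('th, 'y::euclidean_space, 'x::euclidean_space, 'u) model \<Rightarrow> ('y \<times> 'x) measure" where
  "obs_space m = borel_on (outcomes m \<times> covariates m)"

definition sample_space ::
  "('th, 'y::euclidean_space, 'x::euclidean_space, 'u) model \<Rightarrow> nat set \<Rightarrow>
     (nat \<Rightarrow> 'y \<times> 'x) measure" where
  "sample_space m I = PiM I (\<lambda>_. obs_space m)"

text \<open>The kernel \<open>K\<close> is a version of the conditional law of \<open>Y\<close> given \<open>X\<close> under \<open>M\<close>.\<close>

definition cond_law ::
  "'w measure \<Rightarrow> 'x measure \<Rightarrow> ('w \<Rightarrow> 'x) \<Rightarrow> 'y measure \<Rightarrow> ('w \<Rightarrow> 'y) \<Rightarrow> ('x \<Rightarrow> 'y measure) \<Rightarrow> bool"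
  where
  "cond_law M MX X MY Y K \<longleftrightarrow>
     K \<in> MX \<rightarrow>\<^sub>M prob_algebra MY \<and>
     (\<forall>A\<in>sets MX. \<forall>B\<in>sets MY.
        measure M {\<omega>\<in>space M. X \<omega> \<in> A \<and> Y \<omega> \<in> B} =
        (\<integral>x. indicator A x * measure (K x) B \<partial>distr M MX X))"

text \<open>
  Conditional laws are only determined up to null sets of covariate values; the requirement
  at every \<open>x\<close> is that some version satisfies it. The factors \<open>Pi i\<close> need not coincide.
\<close>

definition dgps ::
  "('th, 'y::euclidean_space, 'x::euclidean_space, 'u) model \<Rightarrow> nat \<Rightarrow> 'th \<Rightarrow>
     (nat \<Rightarrow> 'y \<times> 'x) measure set" where
  "dgps m n \<theta> =
     {P. prob_space P \<and> sets P = sets (sample_space m {1..n}) \<and>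
         (\<exists>Pi. P = PiM {1..n} Pi \<and>
            (\<forall>i\<in>{1..n}. prob_space (Pi i) \<and> sets (Pi i) = sets (obs_space m) \<and>
               (\<exists>K. cond_law (Pi i) (borel_on (covariates m)) snd (borel_on (outcomes m)) fst K \<and>
                    (\<forall>x\<in>covariates m. K x \<in> core_dists m \<theta> x))))}"

definition null_params :: "('th, 'y, 'x, 'u) model \<Rightarrow> ('th \<Rightarrow> 'p) \<Rightarrow> 'p \<Rightarrow> 'th set" where
  "null_params m \<phi> \<phi>s = {\<theta>\<in>params m. \<phi> \<theta> = \<phi>s}"

definition dgp_pairs ::
  "('th, 'y::euclidean_space, 'x::euclidean_space, 'u) model \<Rightarrow> ('th \<Rightarrow> 'p) \<Rightarrow> nat \<Rightarrow>
     ('p \<times> (nat \<Rightarrow> 'y \<times> 'x) measure) set" where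
  "dgp_pairs m \<phi> n = {(\<phi>s, P). \<exists>\<theta>\<in>params m. \<phi> \<theta> = \<phi>s \<and> P \<in> dgps m n \<theta>}"

text \<open>
  Sampling scheme: \<open>P\<close> is the law of \<open>(Y\<^sub>i, X\<^sub>i)\<close>, \<open>i = 1..n\<close>, for a sample \<open>(Y\<^sub>i, X\<^sub>i, U\<^sub>i)\<close>
  generated by the model at \<open>\<theta>\<close> that is independent across \<open>i\<close> and whose \<open>(X\<^sub>i, U\<^sub>i)\<close> are
  identically distributed. The sample is realised by the coordinates of a law \<open>M\<close> on the
  product space; the selection of \<open>Y\<^sub>i\<close> from the predicted set is left free and may vary with \<open>i\<close>.
\<close>

definition latent_space ::
  "('th, 'y::euclidean_space, 'x::euclidean_space, 'u::euclidean_space) model \<Rightarrow>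
     ('y \<times> 'x \<times> 'u) measure" where
  "latent_space m = borel_on (outcomes m \<times> covariates m \<times> latents m)"

definition sampling_scheme ::
  "('th, 'y::euclidean_space, 'x::euclidean_space, 'u::euclidean_space) model \<Rightarrow> nat \<Rightarrow> 'th \<Rightarrow>
     (nat \<Rightarrow> 'y \<times> 'x) measure \<Rightarrow> bool" where
  "sampling_scheme m n \<theta> P \<longleftrightarrow>
     (\<exists>M :: (nat \<Rightarrow> 'y \<times> 'x \<times> 'u) measure.
        prob_space M \<and> sets M = sets (PiM {1..n} (\<lambda>_. latent_space m)) \<and>
        prob_space.indep_vars M (\<lambda>_. latent_space m) (\<lambda>i \<omega>. \<omega> i) {1..n} \<and>
        (\<forall>i\<in>{1..n}. \<forall>j\<in>{1..n}.
           distr M (borel_on (covariates m \<times> latents m)) (\<lambda>\<omega>. snd (\<omega> i)) =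
           distr M (borel_on (covariates m \<times> latents m)) (\<lambda>\<omega>. snd (\<omega> j))) \<and>
        (\<forall>i\<in>{1..n}.
           cond_law M (borel_on (covariates m)) (\<lambda>\<omega>. fst (snd (\<omega> i)))
             (borel_on (latents m)) (\<lambda>\<omega>. snd (snd (\<omega> i))) (latent_law m \<theta>) \<and>
           (AE \<omega> in M. fst (\<omega> i) \<in> prediction m \<theta> (snd (snd (\<omega> i))) (fst (snd (\<omega> i))))) \<and>
        P = distr M (sample_space m {1..n}) (\<lambda>\<omega>. \<lambda>i\<in>{1..n}. (fst (\<omega> i), fst (snd (\<omega> i)))))"


section \<open>Cross-fit likelihood-ratio statistic\<close>

text \<open>
  For \<open>p y > 0\<close> the summand at \<open>q y = 0\<close> is \<open>ln (p y / 0) * p y = \<infinity>\<close>. It is spelled out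
  because division and \<open>ln\<close> on the reals would return \<open>0\<close> there.
\<close>

definition lfp_objective ::
  "('th, 'y, 'x, 'u) model \<Rightarrow> ('y \<Rightarrow> real) \<Rightarrow> ('y \<Rightarrow> real) \<Rightarrow> ereal" where
  "lfp_objective m p q =
     (\<Sum>y\<in>outcomes m.
        if q y = 0 then \<infinity> else ereal (ln ((q y + p y) / q y) * (q y + p y)))"

definition lfp_density ::
  "('th, 'y::euclidean_space, 'x, 'u) model \<Rightarrow> ('x \<Rightarrow> 'y \<Rightarrow> real) \<Rightarrow> 'th \<Rightarrow> 'x \<Rightarrow> 'y \<Rightarrow> real" where
  "lfp_density m p \<theta> x = arg_min_on (lfp_objective m (p x)) (core_pmfs m \<theta> x)"

definition likelihood ::
  "nat set \<Rightarrow> ('x \<Rightarrow> 'y \<Rightarrow> real) \<Rightarrow> (nat \<Rightarrow> 'y \<times> 'x) \<Rightarrow> real" where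
  "likelihood D f z = (\<Prod>i\<in>D. f (snd (z i)) (fst (z i)))"

text \<open>
  The choices entering the statistic of one split: the estimator \<open>est1\<close> and the density
  \<open>dens\<close> are functions of the estimation subsample alone, \<open>est0\<close> of the full sample.
\<close>

record ('th, 'y, 'x) fit =
  est1 :: "(nat \<Rightarrow> 'y \<times> 'x) \<Rightarrow> 'th"
  dens :: "(nat \<Rightarrow> 'y \<times> 'x) \<Rightarrow> 'x \<Rightarrow> 'y \<Rightarrow> real"
  est0 :: "(nat \<Rightarrow> 'y \<times> 'x) \<Rightarrow> 'th"

definition null_likelihood ::
  "('th, 'y::euclidean_space, 'x, 'u) model \<Rightarrow> nat set \<Rightarrow> nat set \<Rightarrow> ('th, 'y, 'x) fit \<Rightarrow>
     'th \<Rightarrow> (nat \<Rightarrow> 'y \<times> 'x) \<Rightarrow> real" where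
  "null_likelihood m D0 D1 f \<theta> z = likelihood D0 (lfp_density m (dens f (restrict z D1)) \<theta>) z"

definition valid_fit ::
  "('th, 'y::euclidean_space, 'x::euclidean_space, 'u) model \<Rightarrow> nat \<Rightarrow> 'th set \<Rightarrow>
     nat set \<Rightarrow> nat set \<Rightarrow> ('th, 'y, 'x) fit \<Rightarrow> bool" where
  "valid_fit m n \<Theta>0 D0 D1 f \<longleftrightarrow>
     (\<forall>w\<in>space (sample_space m D1).
        est1 f w \<in> params m \<and>
        (\<forall>x\<in>covariates m.
           dens f w x \<in> core_pmfs m (est1 f w) x \<and> (\<forall>y\<in>outcomes m. 0 < dens f w x y) \<and>
           (\<forall>\<theta>\<in>\<Theta>0. \<exists>!q. is_arg_min (lfp_objective m (dens f w x)) (\<lambda>q. q \<in> core_pmfs m \<theta> x) q))) \<and>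
     (\<forall>z\<in>space (sample_space m {1..n}).
        is_arg_max (\<lambda>\<theta>. null_likelihood m D0 D1 f \<theta> z) (\<lambda>\<theta>. \<theta> \<in> \<Theta>0) (est0 f z)) \<and>
     (\<forall>y\<in>outcomes m.
        (\<lambda>(w, x). dens f w x y)
          \<in> borel_measurable (sample_space m D1 \<Otimes>\<^sub>M borel_on (covariates m)) \<and>
        (\<forall>\<theta>\<in>\<Theta>0. (\<lambda>(w, x). lfp_density m (dens f w) \<theta> x y)
          \<in> borel_measurable (sample_space m D1 \<Otimes>\<^sub>M borel_on (covariates m)))) \<and>
     (\<lambda>z. null_likelihood m D0 D1 f (est0 f z) z) \<in> borel_measurable (sample_space m {1..n})"

text \<open>
  The numerator is positive, so a vanishing denominator gives the value \<open>\<infinity>\<close>.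
\<close>

definition split_LR ::
  "('th, 'y::euclidean_space, 'x, 'u) model \<Rightarrow> nat set \<Rightarrow> nat set \<Rightarrow> ('th, 'y, 'x) fit \<Rightarrow>
     (nat \<Rightarrow> 'y \<times> 'x) \<Rightarrow> ennreal" where
  "split_LR m D0 D1 f z =
     ennreal (likelihood D0 (dens f (restrict z D1)) z) /
     ennreal (null_likelihood m D0 D1 f (est0 f z) z)"

definition crossfit_LR ::
  "('th, 'y::euclidean_space, 'x, 'u) model \<Rightarrow> nat set \<Rightarrow> nat set \<Rightarrow>
     ('th, 'y, 'x) fit \<Rightarrow> ('th, 'y, 'x) fit \<Rightarrow> (nat \<Rightarrow> 'y \<times> 'x) \<Rightarrow> ennreal" where
  "crossfit_LR m D0 D1 f fswap z = (split_LR m D0 D1 f z + split_LR m D1 D0 fswap z) / 2"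

definition confidence_set ::
  "('th, 'y::euclidean_space, 'x, 'u) model \<Rightarrow> nat set \<Rightarrow> nat set \<Rightarrow>
     ('p \<Rightarrow> ('th, 'y, 'x) fit) \<Rightarrow> ('p \<Rightarrow> ('th, 'y, 'x) fit) \<Rightarrow> real \<Rightarrow>
     (nat \<Rightarrow> 'y \<times> 'x) \<Rightarrow> 'p set" where
  "confidence_set m D0 D1 f fswap \<alpha> z =
     {\<phi>s. crossfit_LR m D0 D1 (f \<phi>s) (fswap \<phi>s) z \<le> ennreal (1 / \<alpha>)}"

end

theory Submission
  imports Defs
begin

text \<open>
  The containment functional is that of a random set, so its core contains, for every ordering of
  the outcomes, an element that is stochastically largest for that ordering. Hence the minimiser
  \<open>q\<close> of the objective satisfies \<open>(\<Sum>y. q' y * p y / q y) \<le> 1\<close> for all core elements \<open>q'\<close>, as in the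
  Huber-Strassen theory of least favourable pairs. Conditionally on the estimation subsample, the
  likelihood ratio at the true parameter is a product of independent factors of mean at most one,
  and it dominates the split statistic because the denominator of the latter maximises over the
  null set. Averaging over the two splits keeps the mean at most one, and Markov's inequality
  concludes.
\<close>

section \<open>Two real inequalities: level sets and the slope of r - ln (1 + r)\<close>

text \<open>Layer-cake argument: with \<open>a\<close> a lower bound of \<open>g\<close> on
  \<open>Y\<close>, each \<open>g y - a\<close> is the length of \<open>{a..g y}\<close>, so the
  weighted sum is an integral over \<open>t\<close> of the level sums. The condition
  \<open>sum d Y = 0\<close> pays for the shift by \<open>a\<close>.\<close>

lemma sum_mult_nonneg_of_level_sums:
  fixes d g :: "'a \<Rightarrow> real"
  assumes "finite Y" and "sum d Y = 0"
    and level: "\<And>t. 0 \<le> (\<Sum>y\<in>{y\<in>Y. t \<le> g y}. d y)"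
  shows "0 \<le> (\<Sum>y\<in>Y. d y * g y)"
proof -
  obtain a where a: "\<And>y. y \<in> Y \<Longrightarrow> a \<le> g y"
    using bdd_below_finite[of "g ` Y"] \<open>finite Y\<close> by (auto simp: bdd_below_def)
  have int: "integrable lborel (indicat_real {a..b})" for b
    by (auto simp: emeasure_lborel_Icc_eq)
  have "(\<Sum>y\<in>Y. d y * g y) = (\<Sum>y\<in>Y. d y * (g y - a))"
    using \<open>sum d Y = 0\<close>
    by (simp add: right_diff_distrib sum_subtractf flip: sum_distrib_right)
  also have "\<dots> = (\<Sum>y\<in>Y. LINT t|lborel. d y * indicat_real {a..g y} t)"
    by (intro sum.cong refl) (simp add: a)
  also have "\<dots> = (LINT t|lborel. (\<Sum>y\<in>Y. d y * indicat_real {a..g y} t))"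
    by (intro Bochner_Integration.integral_sum[symmetric] integrable_mult_right int)
  also have "\<dots> \<ge> 0"
  proof (intro integral_nonneg_AE AE_I2)
    fix t
    have "(\<Sum>y\<in>Y. d y * indicat_real {a..g y} t)
        = (if a \<le> t then \<Sum>y\<in>{y\<in>Y. t \<le> g y}. d y else 0)"
      unfolding sum.inter_filter[OF \<open>finite Y\<close>]
      by (cases "a \<le> t") (auto intro!: sum.cong sum.neutral)
    then show "0 \<le> (\<Sum>y\<in>Y. d y * indicat_real {a..g y} t)"
      using level by simp
  qed
  finally show ?thesis .
qed

text \<open>The map r - ln (1 + r) has derivative r / (1 + r), which increases and so stays above c
  / (1 + c) from \<open>c\<close> on. The bound ln u \<le> u - 1 at u = (1 + r) / (1 + s) yields
  this directly. It allows a linear term of slope c / (1 + c) to be split off while the remainder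
  stays nondecreasing.\<close>

lemma diff_ln_add_one_slope:
  fixes s r :: real
  assumes "0 < c" and "c \<le> s" and "s \<le> r"
  shows "c / (1 + c) * (r - s) \<le> (r - ln (1 + r)) - (s - ln (1 + s))"
proof -
  have "ln (1 + r) - ln (1 + s) = ln ((1 + r) / (1 + s))"
    using assms by (simp add: ln_div)
  also have "\<dots> \<le> (1 + r) / (1 + s) - 1"
    using assms by (intro ln_le_minus_one) auto
  also have "\<dots> = (r - s) / (1 + s)"
    using assms by (simp add: field_simps)
  also have "\<dots> \<le> (r - s) / (1 + c)"
    using assms by (intro divide_left_mono) auto
  finally have "ln (1 + r) - ln (1 + s) \<le> (r - s) / (1 + c)" .
  moreover have "c / (1 + c) * (r - s) = (r - s) - (r - s) / (1 + c)"
    using assms by (simp add: field_simps)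
  ultimately show ?thesis by simp
qed

section \<open>Mass functions in the core of the containment functional\<close>

lemma space_borel_on [simp]: "space (borel_on S) = S"
  by (simp add: space_restrict_space)

lemma sets_borel_on_finite:
  fixes S :: "'a::t1_space set"
  assumes "finite S"
  shows "sets (borel_on S) = Pow S"
proof -
  have "A \<in> sets borel" if "A \<subseteq> S" for A
    using finite_subset[OF that assms] by (intro borel_closed finite_imp_closed)
  then show ?thesis
    by (auto simp: sets_restrict_space image_iff)
qed

text \<open>Every subset of the finite outcome set is measurable, so a core measure is determined by
  its point masses, and conversely \<open>point_measure\<close> rebuilds the measure from them. The
  core thus becomes a polytope given by linear constraints on \<open>q\<close>.\<close>

lemma core_pmfs_iff:
  assumes fin: "finite (outcomes m)"
  shows "q \<in> core_pmfs m \<theta> x \<longleftrightarrow>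
    (\<forall>y. 0 \<le> q y) \<and> (\<forall>y. y \<notin> outcomes m \<longrightarrow> q y = 0) \<and> sum q (outcomes m) = 1 \<and>
    (\<forall>A\<subseteq>outcomes m. containment m \<theta> x A \<le> sum q A)" (is "?L \<longleftrightarrow> ?R")
proof
  assume ?L
  then obtain Q where Q: "prob_space Q" "sets Q = sets (borel_on (outcomes m))"
    "\<And>A. A \<subseteq> outcomes m \<Longrightarrow> containment m \<theta> x A \<le> measure Q A"
    and q: "q = (\<lambda>y. measure Q {y})"
    by (auto simp: core_pmfs_def core_dists_def)
  interpret prob_space Q by fact
  have sets: "sets Q = Pow (outcomes m)"
    using Q(2) sets_borel_on_finite[OF fin] by simp
  have space: "space Q = outcomes m"
    using sets_eq_imp_space_eq[OF Q(2)] by simp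
  have sum: "sum q A = measure Q A" if "A \<subseteq> outcomes m" for A
    unfolding q using that fin
    by (intro finite_measure_eq_sum_singleton[symmetric]) (auto simp: sets intro: finite_subset)
  show ?R
    using Q(3) prob_space sum by (auto simp: q space sets measure_notin_sets)
next
  assume R: ?R
  define Q where "Q = point_measure (outcomes m) (\<lambda>y. ennreal (q y))"
  have em: "emeasure Q A = ennreal (sum q A)" if "A \<subseteq> outcomes m" for A
    unfolding Q_def using R that fin
    by (subst emeasure_point_measure_finite) auto
  have sets: "sets Q = Pow (outcomes m)" and space: "space Q = outcomes m"
    by (simp_all add: Q_def sets_point_measure space_point_measure)
  have me: "measure Q A = sum q A" if "A \<subseteq> outcomes m" for A
    using em[OF that] R by (simp add: measure_def sum_nonneg)
  have "prob_space Q"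
    using em[of "outcomes m"] R by (intro prob_spaceI) (simp add: space)
  then have "Q \<in> core_dists m \<theta> x"
    using R by (simp add: core_dists_def sets sets_borel_on_finite[OF fin] me)
  moreover have "q = (\<lambda>y. measure Q {y})"
  proof
    fix y show "q y = measure Q {y}"
      using R me[of "{y}"] by (cases "y \<in> outcomes m") (auto simp: measure_notin_sets sets)
  qed
  ultimately show ?L
    by (auto simp: core_pmfs_def)
qed

lemma core_pmfs_convex:
  assumes fin: "finite (outcomes m)" and q: "q \<in> core_pmfs m \<theta> x" "r \<in> core_pmfs m \<theta> x"
    and t: "0 \<le> t" "t \<le> 1"
  shows "(\<lambda>y. q y + t * (r y - q y)) \<in> core_pmfs m \<theta> x"
proof -
  have eq: "q y + t * (r y - q y) = (1 - t) * q y + t * r y" for y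
    by (simp add: algebra_simps)
  have "containment m \<theta> x A \<le> (1 - t) * sum q A + t * sum r A" if "A \<subseteq> outcomes m" for A
  proof -
    have "containment m \<theta> x A = (1 - t) * containment m \<theta> x A + t * containment m \<theta> x A"
      by (simp add: algebra_simps)
    also have "\<dots> \<le> (1 - t) * sum q A + t * sum r A"
      using q that t by (intro add_mono mult_left_mono) (auto simp: core_pmfs_iff[OF fin])
    finally show ?thesis .
  qed
  then show ?thesis
    using q t unfolding eq
    by (auto simp: core_pmfs_iff[OF fin] sum.distrib simp flip: sum_distrib_left)
qed

text \<open>Selecting from every prediction set an outcome maximising \<open>r\<close> gives a core element under which
  \<open>r\<close> is stochastically largest.\<close>

lemma core_pmfs_maximal:
  fixes m :: "('th, 'y::euclidean_space, 'x::euclidean_space, 'u::euclidean_space) model"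
    and r :: "'y \<Rightarrow> real"
  assumes valid: "valid_model m" and \<theta>: "\<theta> \<in> params m" and x: "x \<in> covariates m"
  obtains q where "q \<in> core_pmfs m \<theta> x"
    and "\<And>q' t. q' \<in> core_pmfs m \<theta> x \<Longrightarrow>
      (\<Sum>y\<in>{y\<in>outcomes m. t \<le> r y}. q' y) \<le> (\<Sum>y\<in>{y\<in>outcomes m. t \<le> r y}. q y)"
proof -
  let ?Y = "outcomes m" and ?F = "latent_law m \<theta> x"
  let ?G = "\<lambda>u. prediction m \<theta> u x"
  have fin: "finite ?Y"
    using valid by (simp add: valid_model_def)
  have "?F \<in> space (prob_algebra (borel_on (latents m)))"
    using valid \<theta> x by (intro measurable_space[of "latent_law m \<theta>" "borel_on (covariates m)"])
      (auto simp: valid_model_def)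
  then have F: "prob_space ?F" "sets ?F = sets (borel_on (latents m))"
    by (auto simp: space_prob_algebra)
  interpret prob_space ?F by fact
  have space: "space ?F = latents m"
    using sets_eq_imp_space_eq[OF F(2)] by simp
  have G: "?G u \<noteq> {}" "?G u \<subseteq> ?Y" if "u \<in> latents m" for u
    using valid \<theta> x that by (auto simp: valid_model_def)
  have hit: "{u \<in> space ?F. y \<in> ?G u} \<in> events" if "y \<in> ?Y" for y
  proof -
    \<comment> \<open>This complement of a finite set is open, and a prediction set, lying inside
      \<open>?Y\<close>, meets it exactly when it contains \<open>y\<close>. Weak measurability
      thereby yields the event that \<open>y\<close> is predicted, after slicing at the fixed
      \<open>x\<close>.\<close>
    define V where "V = - (?Y - {y})"
    have "open V"
      using fin unfolding V_def by (intro open_Compl finite_imp_closed) auto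
    then have "{(u, x) \<in> latents m \<times> covariates m. prediction m \<theta> u x \<inter> V \<noteq> {}}
        \<in> sets (borel_on (latents m \<times> covariates m))"
      using valid \<theta> by (auto simp: valid_model_def)
    moreover have "(\<lambda>u. (u, x)) \<in> ?F \<rightarrow>\<^sub>M borel_on (latents m \<times> covariates m)"
    proof -
      have "(\<lambda>u. (u, x)) \<in> borel \<rightarrow>\<^sub>M borel"
        by (rule borel_measurable_continuous_onI) (intro continuous_intros)
      then show ?thesis
        unfolding measurable_cong_sets[OF F(2) refl]
        by (rule measurable_restrict_space3) (use x in auto)
    qed
    ultimately have "(\<lambda>u. (u, x)) -` {(u, x) \<in> latents m \<times> covariates m.
        prediction m \<theta> u x \<inter> V \<noteq> {}} \<inter> space ?F \<in> events"
      by (rule measurable_sets[rotated])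
    also have "(\<lambda>u. (u, x)) -` {(u, x) \<in> latents m \<times> covariates m.
        prediction m \<theta> u x \<inter> V \<noteq> {}} \<inter> space ?F = {u \<in> space ?F. y \<in> ?G u}"
      using G that x by (auto simp: V_def space)
    finally show ?thesis .
  qed
  \<comment> \<open>A prediction set takes only finitely many values, each described by which
    outcomes it contains, so an arbitrary predicate \<open>\<Phi>\<close> of it gives an
    event.\<close>
  have ev: "{u \<in> space ?F. \<Phi> (?G u)} \<in> events" for \<Phi>
  proof -
    have "{u \<in> space ?F. \<Phi> (?G u)} =
        {u \<in> space ?F. \<exists>S\<in>Pow ?Y. \<Phi> S \<and> (\<forall>y\<in>?Y. y \<in> S \<longleftrightarrow> y \<in> ?G u)}"
    proof (intro Collect_cong conj_cong refl)
      fix u assume "u \<in> space ?F"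
      then have "?G u \<subseteq> ?Y" using G space by simp
      moreover have "S = ?G u" if "S \<subseteq> ?Y" "\<forall>y\<in>?Y. y \<in> S \<longleftrightarrow> y \<in> ?G u" for S
        using that \<open>?G u \<subseteq> ?Y\<close> by blast
      ultimately show "\<Phi> (?G u) \<longleftrightarrow> (\<exists>S\<in>Pow ?Y. \<Phi> S \<and> (\<forall>y\<in>?Y. y \<in> S \<longleftrightarrow> y \<in> ?G u))"
        by auto
    qed
    moreover have "{u \<in> space ?F. y \<in> S \<longleftrightarrow> y \<in> ?G u} \<in> events" if "y \<in> ?Y" for y S
      using hit[OF that] sets.sets_Collect_neg[OF hit[OF that]] by (cases "y \<in> S") auto
    then have "{u \<in> space ?F. \<forall>y\<in>?Y. y \<in> S \<longleftrightarrow> y \<in> ?G u} \<in> events" for S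
      by (rule sets.sets_Collect_finite_All[OF _ fin])
    then have "{u \<in> space ?F. \<Phi> S \<and> (\<forall>y\<in>?Y. y \<in> S \<longleftrightarrow> y \<in> ?G u)} \<in> events" for S
      by (cases "\<Phi> S") simp_all
    then have "{u \<in> space ?F. \<exists>S\<in>Pow ?Y. \<Phi> S \<and> (\<forall>y\<in>?Y. y \<in> S \<longleftrightarrow> y \<in> ?G u)} \<in> events"
      by (rule sets.sets_Collect_finite_Ex) (simp add: fin)
    ultimately show ?thesis by simp
  qed
  \<comment> \<open>The selection depends on \<open>u\<close> only through the prediction set, ties
    being broken once per set by \<open>SOME\<close>. This makes its measurability an instance of
    \<open>ev\<close>.\<close>
  define c where "c S = (SOME y. y \<in> S \<and> (\<forall>y'\<in>S. r y' \<le> r y))" for S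
  have c_max: "c S \<in> S \<and> (\<forall>y'\<in>S. r y' \<le> r (c S))" if "finite S" "S \<noteq> {}" for S
  proof -
    have "Max (r ` S) \<in> r ` S"
      using that by (intro Max_in) auto
    then obtain y where "y \<in> S" "r y = Max (r ` S)"
      by auto
    then have "\<exists>y. y \<in> S \<and> (\<forall>y'\<in>S. r y' \<le> r y)"
      using that by auto
    from someI_ex[OF this] show ?thesis
      unfolding c_def .
  qed
  have c: "c (?G u) \<in> ?G u \<and> (\<forall>y'\<in>?G u. r y' \<le> r (c (?G u)))" if "u \<in> latents m" for u
    using G[OF that] fin by (intro c_max) (auto intro: finite_subset)
  have cY: "c (?G u) \<in> ?Y" if "u \<in> latents m" for u
    using c[OF that] G[OF that] by blast
  define q where "q y = prob {u \<in> space ?F. c (?G u) = y}" for y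
  have sum_q: "sum q A = prob {u \<in> space ?F. c (?G u) \<in> A}" if "A \<subseteq> ?Y" for A
  proof -
    have "prob {u \<in> space ?F. c (?G u) \<in> A} = prob (\<Union>y\<in>A. {u \<in> space ?F. c (?G u) = y})"
      by (rule arg_cong[of _ _ prob]) auto
    also have "\<dots> = sum q A"
      unfolding q_def
    proof (rule finite_measure_finite_Union)
      show "finite A" using fin that finite_subset by blast
      show "(\<lambda>y. {u \<in> space ?F. c (?G u) = y}) ` A \<subseteq> events"
        using ev[of "\<lambda>S. c S = y" for y] by auto
    qed (auto simp: disjoint_family_on_def)
    finally show ?thesis ..
  qed
  have contain: "containment m \<theta> x A = prob {u \<in> space ?F. ?G u \<subseteq> A}" for A
  proof -
    have "containment m \<theta> x A = (\<integral>u. indicator {u \<in> space ?F. ?G u \<subseteq> A} u \<partial>?F)"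
      unfolding containment_def by (intro Bochner_Integration.integral_cong) auto
    then show ?thesis using ev[of "\<lambda>S. S \<subseteq> A"] by simp
  qed
  show thesis
  proof (rule that)
    have "q y = 0" if "y \<notin> ?Y" for y
    proof -
      have "{u \<in> space ?F. c (?G u) = y} = {}"
        using cY that by (auto simp: space)
      then show ?thesis by (simp only: q_def measure_empty)
    qed
    moreover have "sum q ?Y = 1"
    proof -
      have "{u \<in> space ?F. c (?G u) \<in> ?Y} = space ?F"
        using cY by (auto simp: space)
      then show ?thesis using sum_q[of ?Y] prob_space by simp
    qed
    moreover have "containment m \<theta> x A \<le> sum q A" if "A \<subseteq> ?Y" for A
      unfolding contain sum_q[OF that]
    proof (rule finite_measure_mono)
      show "{u \<in> space ?F. ?G u \<subseteq> A} \<subseteq> {u \<in> space ?F. c (?G u) \<in> A}"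
        using c by (auto simp: space)
    qed (rule ev[of "\<lambda>S. c S \<in> A"])
    ultimately show "q \<in> core_pmfs m \<theta> x"
      by (auto simp: core_pmfs_iff[OF fin] q_def)
  next
    fix q' t assume q': "q' \<in> core_pmfs m \<theta> x"
    let ?L = "{y\<in>?Y. t \<le> r y}"
    \<comment> \<open>The core constraint is applied to the complement of the level set, which must
      carry at least the probability that the prediction set misses \<open>?L\<close>. When the
      prediction set does meet \<open>?L\<close>, its maximiser of \<open>r\<close> lies in
      \<open>?L\<close>, so the bound is attained by \<open>q\<close>.\<close>
    have "sum q' ?L = sum q' ?Y - sum q' (?Y - ?L)"
      using fin by (subst sum_diff) auto
    also have "\<dots> \<le> 1 - prob {u \<in> space ?F. ?G u \<subseteq> ?Y - ?L}"
      using q' by (auto simp: core_pmfs_iff[OF fin] simp flip: contain)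
    also have "\<dots> = prob (space ?F - {u \<in> space ?F. ?G u \<subseteq> ?Y - ?L})"
      by (rule prob_compl[symmetric, OF ev[of "\<lambda>S. S \<subseteq> ?Y - ?L"]])
    also have "space ?F - {u \<in> space ?F. ?G u \<subseteq> ?Y - ?L} = {u \<in> space ?F. c (?G u) \<in> ?L}"
    proof (intro set_eqI)
      fix u
      show "u \<in> space ?F - {u \<in> space ?F. ?G u \<subseteq> ?Y - ?L} \<longleftrightarrow> u \<in> {u \<in> space ?F. c (?G u) \<in> ?L}"
      proof (cases "u \<in> latents m")
        case True
        have "t \<le> r (c (?G u))" if "y \<in> ?G u" "t \<le> r y" for y
          using c[OF True] that order_trans by blast
        then show ?thesis
          using c[OF True] G[OF True] True unfolding space by blast
      qed (simp add: space)
    qed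
    also have "prob \<dots> = sum q ?L"
      by (rule sum_q[symmetric]) auto
    finally show "sum q' ?L \<le> sum q ?L" .
  qed
qed

section \<open>Optimality of the LFP-based density\<close>

text \<open>The derivative of ln ((a + p) / a) (a + p) in a is ln (1 + p / a) - p / a. Hence the
  objective along the segment from \<open>q\<close> to \<open>r\<close> has derivative at 0 equal to
  minus the stated sum, and a positive sum would make the objective decrease near 0. Keeping t < 1
  leaves the points of the segment positive even where \<open>r\<close> vanishes.\<close>

lemma lfp_objective_first_order:
  fixes p q r :: "'y \<Rightarrow> real"
  assumes fin: "finite (outcomes m)"
    and pos: "\<And>y. y \<in> outcomes m \<Longrightarrow> 0 < p y" "\<And>y. y \<in> outcomes m \<Longrightarrow> 0 < q y"
      "\<And>y. y \<in> outcomes m \<Longrightarrow> 0 \<le> r y"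
    and min: "\<And>t. 0 < t \<Longrightarrow> t < 1 \<Longrightarrow>
      lfp_objective m p q \<le> lfp_objective m p (\<lambda>y. q y + t * (r y - q y))"
  shows "(\<Sum>y\<in>outcomes m. (r y - q y) * (p y / q y - ln (1 + p y / q y))) \<le> 0"
proof (rule ccontr)
  \<comment> \<open>The objective on the segment as a real function, with the logarithm of the
    quotient written as a difference. Its derivative at 0 is two-sided, whereas it is compared with
    the objective only for 0 \<le> t < 1.\<close>
  define J where "J t = (\<Sum>y\<in>outcomes m.
    (ln (q y + t * (r y - q y) + p y) - ln (q y + t * (r y - q y))) * (q y + t * (r y - q y) + p y))" for t
  have objective: "lfp_objective m p (\<lambda>y. q y + t * (r y - q y)) = ereal (J t)"
    if t: "0 \<le> t" "t < 1" for t
  proof -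
    have "0 < q y + t * (r y - q y)" if "y \<in> outcomes m" for y
    proof -
      have "0 < (1 - t) * q y + t * r y"
        using pos that t by (intro add_pos_nonneg mult_pos_pos mult_nonneg_nonneg) auto
      then show ?thesis by (simp add: algebra_simps)
    qed
    then show ?thesis
      unfolding lfp_objective_def J_def sum_ereal[symmetric]
      using pos by (intro sum.cong refl) (auto simp: ln_div less_imp_neq[symmetric] add_pos_pos)
  qed
  let ?D = "\<Sum>y\<in>outcomes m. (r y - q y) * (p y / q y - ln (1 + p y / q y))"
  assume "\<not> ?D \<le> 0"
  have "(J has_real_derivative - ?D) (at 0)"
    unfolding J_def sum_negf[symmetric]
  proof (intro DERIV_sum)
    fix y assume "y \<in> outcomes m"
    then have "0 < p y" "0 < q y" using pos by auto
    then have "ln (1 + p y / q y) = ln (q y + p y) - ln (q y)"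
      using ln_div[of "q y + p y" "q y"] by (simp add: add_divide_distrib)
    moreover have "((r y - q y) / (q y + p y) - (r y - q y) / q y) * (q y + p y)
        = - ((r y - q y) * (p y / q y))"
      using \<open>0 < p y\<close> \<open>0 < q y\<close> by (simp add: divide_simps) (simp add: algebra_simps)
    moreover have "((\<lambda>t. (ln (q y + t * (r y - q y) + p y) - ln (q y + t * (r y - q y)))
        * (q y + t * (r y - q y) + p y)) has_real_derivative
        ((r y - q y) / (q y + p y) - (r y - q y) / q y) * (q y + p y)
        + (ln (q y + p y) - ln (q y)) * (r y - q y)) (at 0)"
      using \<open>0 < p y\<close> \<open>0 < q y\<close> by (auto intro!: derivative_eq_intros)
    moreover have "- ((r y - q y) * (p y / q y)) + (ln (q y + p y) - ln (q y)) * (r y - q y)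
        = - ((r y - q y) * (p y / q y - (ln (q y + p y) - ln (q y))))"
      by (simp only: right_diff_distrib minus_diff_eq mult.commute)
    ultimately show "((\<lambda>t. (ln (q y + t * (r y - q y) + p y) - ln (q y + t * (r y - q y)))
        * (q y + t * (r y - q y) + p y)) has_real_derivative
        - ((r y - q y) * (p y / q y - ln (1 + p y / q y)))) (at 0)"
      by (simp only:)
  qed
  with \<open>\<not> ?D \<le> 0\<close> obtain d where "0 < d" and d: "\<And>h. 0 < h \<Longrightarrow> h < d \<Longrightarrow> J (0 + h) < J 0"
    using DERIV_neg_dec_right[of J "- ?D" 0] by auto
  define h where "h = min (d / 2) (1 / 2)"
  have h: "0 < h" "h < d" "h < 1"
    using \<open>0 < d\<close> by (auto simp: h_def min_def)
  have "ereal (J 0) \<le> ereal (J h)"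
    using min[of h] h objective[of 0] objective[of h] by simp
  with d[of h] h show False by simp
qed

text \<open>The minimiser of the objective also minimises the Kullback-Leibler divergence from \<open>p\<close> over
  the core: its first-order condition controls the increasing transform \<open>r - ln (1 + r)\<close> of
  \<open>r = p / q\<close>, and stochastic maximality in the core depends only on the ordering of \<open>r\<close>.\<close>

lemma sum_core_mult_ratio_le:
  fixes m :: "('th, 'y::euclidean_space, 'x::euclidean_space, 'u::euclidean_space) model"
  assumes valid: "valid_model m" and \<theta>: "\<theta> \<in> params m" and x: "x \<in> covariates m"
    and p: "\<And>y. y \<in> outcomes m \<Longrightarrow> 0 < p y" "sum p (outcomes m) = 1"
    and q: "is_arg_min (lfp_objective m p) (\<lambda>q. q \<in> core_pmfs m \<theta> x) q"
    and qpos: "\<And>y. y \<in> outcomes m \<Longrightarrow> 0 < q y"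
    and q': "q' \<in> core_pmfs m \<theta> x"
  shows "(\<Sum>y\<in>outcomes m. q' y * (p y / q y)) \<le> 1"
proof -
  let ?Y = "outcomes m"
  have fin: "finite ?Y" using valid by (simp add: valid_model_def)
  have qc: "q \<in> core_pmfs m \<theta> x" using q by (simp add: is_arg_min_def)
  define r where "r y = p y / q y" for y
  have rpos: "0 < r y" if "y \<in> ?Y" for y
    using p qpos that by (simp add: r_def)
  obtain s where s: "s \<in> core_pmfs m \<theta> x"
    and dom: "\<And>q' t. q' \<in> core_pmfs m \<theta> x \<Longrightarrow>
      (\<Sum>y\<in>{y\<in>?Y. t \<le> r y}. q' y) \<le> (\<Sum>y\<in>{y\<in>?Y. t \<le> r y}. s y)"
    by (rule core_pmfs_maximal[OF valid \<theta> x, of r]) (rule that)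
  have total: "sum u ?Y = 1" if "u \<in> core_pmfs m \<theta> x" for u
    using that by (simp add: core_pmfs_iff[OF fin])
  \<comment> \<open>If \<open>g\<close> is nondecreasing on the values of \<open>r\<close>, a
    nonempty level set of \<open>g (r y)\<close> is a level set of \<open>r\<close>, with threshold
    the least value of \<open>r\<close> on it. Dominance of \<open>s\<close> therefore passes from
    level sets to expectations of \<open>g (r y)\<close>.\<close>
  have dom_sum: "(\<Sum>y\<in>?Y. u y * g (r y)) \<le> (\<Sum>y\<in>?Y. s y * g (r y))"
    if u: "u \<in> core_pmfs m \<theta> x" and mono: "\<And>a b. a \<in> r ` ?Y \<Longrightarrow> b \<in> r ` ?Y \<Longrightarrow> a \<le> b \<Longrightarrow> g a \<le> g b"
    for u and g :: "real \<Rightarrow> real"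
  proof -
    have "0 \<le> (\<Sum>y\<in>?Y. (s y - u y) * g (r y))"
    proof (rule sum_mult_nonneg_of_level_sums[OF fin])
      show "(\<Sum>y\<in>?Y. s y - u y) = 0"
        using total[OF s] total[OF u] by (simp add: sum_subtractf)
      fix t
      show "0 \<le> (\<Sum>y\<in>{y\<in>?Y. t \<le> g (r y)}. s y - u y)"
      proof (cases "{y\<in>?Y. t \<le> g (r y)} = {}")
        case False
        define a where "a = Min (r ` {y\<in>?Y. t \<le> g (r y)})"
        have "a \<in> r ` {y\<in>?Y. t \<le> g (r y)}"
          unfolding a_def using False fin by (intro Min_in) auto
        then obtain y0 where y0: "y0 \<in> ?Y" "t \<le> g (r y0)" "a = r y0"
          by auto
        have "a \<le> r y" if "y \<in> ?Y" "t \<le> g (r y)" for y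
          unfolding a_def using that fin by (intro Min_le) auto
        moreover have "t \<le> g (r y)" if "y \<in> ?Y" "a \<le> r y" for y
          using mono[of "r y0" "r y"] y0 that by simp
        ultimately have "{y\<in>?Y. t \<le> g (r y)} = {y\<in>?Y. a \<le> r y}"
          by blast
        then show ?thesis
          using dom[OF u] by (simp add: sum_subtractf)
      next
        case True
        show ?thesis unfolding True by simp
      qed
    qed
    then show ?thesis by (simp add: left_diff_distrib sum_subtractf)
  qed
  have "?Y \<noteq> {}" using p(2) by auto
  define c where "c = Min (r ` ?Y)"
  have "c \<in> r ` ?Y"
    unfolding c_def using fin \<open>?Y \<noteq> {}\<close> by (intro Min_in) auto
  then have "0 < c" using rpos by auto
  have c_le: "c \<le> a" if "a \<in> r ` ?Y" for a
    using that fin by (simp add: c_def)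
  \<comment> \<open>On \<open>r \<ge> c\<close> the transform has slope at least \<open>k\<close>, so \<open>g\<close> is still nondecreasing there and the
    dominance inequality for \<open>g\<close> turns the first-order condition into one for \<open>r\<close> itself.\<close>
  let ?k = "c / (1 + c)"
  define g where "g a = (a - ln (1 + a)) - ?k * a" for a :: real
  have "(\<Sum>y\<in>?Y. q y * g (r y)) \<le> (\<Sum>y\<in>?Y. s y * g (r y))"
  proof (rule dom_sum[OF qc])
    fix a b assume "a \<in> r ` ?Y" "b \<in> r ` ?Y" "a \<le> b"
    then show "g a \<le> g b"
      using diff_ln_add_one_slope[OF \<open>0 < c\<close> c_le, of a b] by (simp add: g_def right_diff_distrib)
  qed
  moreover have "(\<Sum>y\<in>?Y. (s y - q y) * (r y - ln (1 + r y))) \<le> 0"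
    unfolding r_def
  proof (rule lfp_objective_first_order[OF fin])
    fix t :: real assume "0 < t" "t < 1"
    then have "(\<lambda>y. q y + t * (s y - q y)) \<in> core_pmfs m \<theta> x"
      by (intro core_pmfs_convex fin qc s) auto
    then show "lfp_objective m p q \<le> lfp_objective m p (\<lambda>y. q y + t * (s y - q y))"
      using q by (auto simp: is_arg_min_def not_less)
  qed (use p qpos s in \<open>auto simp: core_pmfs_iff[OF fin]\<close>)
  moreover have "(\<Sum>y\<in>?Y. (s y - q y) * (r y - ln (1 + r y))) =
      (\<Sum>y\<in>?Y. s y * g (r y)) - (\<Sum>y\<in>?Y. q y * g (r y))
      + ?k * ((\<Sum>y\<in>?Y. s y * r y) - (\<Sum>y\<in>?Y. q y * r y))"
    unfolding g_def sum_distrib_left sum_subtractf[symmetric] sum.distrib[symmetric]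
    by (intro sum.cong refl) (simp add: algebra_simps)
  ultimately have "?k * ((\<Sum>y\<in>?Y. s y * r y) - (\<Sum>y\<in>?Y. q y * r y)) \<le> 0"
    by linarith
  then have "(\<Sum>y\<in>?Y. s y * r y) \<le> (\<Sum>y\<in>?Y. q y * r y)"
    using \<open>0 < c\<close> by (simp add: mult_le_0_iff divide_le_0_iff)
  also have "\<dots> = sum p ?Y"
    using qpos by (intro sum.cong refl) (simp add: r_def less_imp_neq[symmetric])
  finally have "(\<Sum>y\<in>?Y. s y * r y) \<le> 1"
    using p(2) by simp
  \<comment> \<open>Dominance is used a second time, now with the identity for \<open>g\<close>, to
    pass from the extremal element \<open>s\<close> to an arbitrary core element.\<close>
  moreover have "(\<Sum>y\<in>?Y. q' y * r y) \<le> (\<Sum>y\<in>?Y. s y * r y)"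
    using dom_sum[OF q', of "\<lambda>a. a"] by simp
  ultimately show ?thesis by (simp add: r_def)
qed

lemma core_pmfs_ratio_le_one:
  fixes m :: "('th, 'y::euclidean_space, 'x::euclidean_space, 'u::euclidean_space) model"
  assumes valid: "valid_model m" and \<theta>: "\<theta> \<in> params m" and x: "x \<in> covariates m"
    and p: "\<And>y. y \<in> outcomes m \<Longrightarrow> 0 < p y" "sum p (outcomes m) = 1"
    and unique: "\<exists>!q. is_arg_min (lfp_objective m p) (\<lambda>q. q \<in> core_pmfs m \<theta> x) q"
    and q: "q = arg_min_on (lfp_objective m p) (core_pmfs m \<theta> x)"
    and q': "q' \<in> core_pmfs m \<theta> x"
  shows "(\<Sum>y\<in>outcomes m. ennreal (q' y) * (ennreal (p y) / ennreal (q y))) \<le> 1"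
proof -
  have fin: "finite (outcomes m)" using valid by (simp add: valid_model_def)
  have min: "is_arg_min (lfp_objective m p) (\<lambda>q. q \<in> core_pmfs m \<theta> x) q"
    unfolding q arg_min_on_def arg_min_def using unique by (metis someI_ex)
  then have qc: "q \<in> core_pmfs m \<theta> x" by (simp add: is_arg_min_def)
  have q'0: "0 \<le> q' y" for y using q' by (simp add: core_pmfs_iff[OF fin])
  show ?thesis
  proof (cases "\<exists>y\<in>outcomes m. q y = 0")
    case False
    then have qpos: "0 < q y" if "y \<in> outcomes m" for y
      using qc that by (auto simp: core_pmfs_iff[OF fin] order.strict_iff_order)
    have "(\<Sum>y\<in>outcomes m. ennreal (q' y) * (ennreal (p y) / ennreal (q y)))
        = (\<Sum>y\<in>outcomes m. ennreal (q' y * (p y / q y)))"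
      using p(1) qpos q'0
      by (intro sum.cong refl) (simp add: divide_ennreal less_imp_le flip: ennreal_mult)
    also have "\<dots> = ennreal (\<Sum>y\<in>outcomes m. q' y * (p y / q y))"
      using p(1) qpos q'0
      by (intro sum_ennreal mult_nonneg_nonneg divide_nonneg_nonneg) (auto intro: less_imp_le)
    also have "\<dots> \<le> 1"
      using sum_core_mult_ratio_le[OF valid \<theta> x p min qpos q'] by simp
    finally show ?thesis .
  next
    case True
    \<comment> \<open>An infinite minimum makes every core element a minimiser, so uniqueness leaves only \<open>q\<close>.\<close>
    then have "lfp_objective m p q = \<infinity>"
      unfolding lfp_objective_def sum_Pinfty using fin by auto
    then have "is_arg_min (lfp_objective m p) (\<lambda>q. q \<in> core_pmfs m \<theta> x) q'"
      using min q' by (simp add: is_arg_min_def)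
    then have "q' = q" using unique min by blast
    have "(\<Sum>y\<in>outcomes m. ennreal (q' y) * (ennreal (p y) / ennreal (q y)))
        \<le> (\<Sum>y\<in>outcomes m. ennreal (p y))"
    proof (intro sum_mono)
      fix y assume "y \<in> outcomes m"
      then have "0 < p y" by (rule p(1))
      show "ennreal (q' y) * (ennreal (p y) / ennreal (q y)) \<le> ennreal (p y)"
      proof (cases "q y = 0")
        case False
        then have "0 < q y" using q'0[of y] \<open>q' = q\<close> by simp
        then show ?thesis
          using \<open>0 < p y\<close> \<open>q' = q\<close> by (simp add: divide_ennreal flip: ennreal_mult)
      qed (simp add: \<open>q' = q\<close>)
    qed
    also have "\<dots> = 1"
      using p by (subst sum_ennreal) (auto intro: less_imp_le)
    finally show ?thesis .
  qed
qed

section \<open>Integration against a conditional law\<close>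

text \<open>\<open>cond_law\<close> speaks of rectangles only. Read as an identity of measures on
  \<open>MX\<close>, it says that \<open>M\<close> weighted by the event that \<open>Y\<close> is in
  \<open>B\<close> and pushed forward along \<open>X\<close> has density
  \<open>measure (K x) B\<close> with respect to the law of \<open>X\<close>; integrating
  \<open>g\<close> against both measures gives the claim.\<close>

lemma nn_integral_cond_law:
  assumes "cond_law M MX X MY Y K" and "prob_space M"
    and X[measurable]: "X \<in> M \<rightarrow>\<^sub>M MX" and Y[measurable]: "Y \<in> M \<rightarrow>\<^sub>M MY"
    and B[measurable]: "B \<in> sets MY" and g[measurable]: "g \<in> borel_measurable MX"
  shows "(\<integral>\<^sup>+\<omega>. indicator B (Y \<omega>) * g (X \<omega>) \<partial>M)
    = (\<integral>\<^sup>+x. ennreal (measure (K x) B) * g x \<partial>distr M MX X)"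
proof -
  interpret prob_space M by fact
  interpret D: prob_space "distr M MX X" by (rule prob_space_distr[OF X])
  have K: "K \<in> MX \<rightarrow>\<^sub>M prob_algebra MY"
    and law: "\<And>A. A \<in> sets MX \<Longrightarrow> prob {\<omega>\<in>space M. X \<omega> \<in> A \<and> Y \<omega> \<in> B} =
      (\<integral>x. indicator A x * measure (K x) B \<partial>distr M MX X)"
    using \<open>cond_law M MX X MY Y K\<close> B by (auto simp: cond_law_def)
  have KB[measurable]: "(\<lambda>x. measure (K x) B) \<in> borel_measurable MX"
    by (rule measurable_compose[OF K measurable_measure_prob_algebra[OF B]])
  have K1: "measure (K x) B \<le> 1" if "x \<in> space MX" for x
    using measurable_space[OF K that] by (auto simp: space_prob_algebra intro: prob_space.prob_le_1)
  have "distr (density M (\<lambda>\<omega>. indicator B (Y \<omega>))) MX X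
      = density (distr M MX X) (\<lambda>x. ennreal (measure (K x) B))"
  proof (rule measure_eqI)
    fix A assume "A \<in> sets (distr (density M (\<lambda>\<omega>. indicator B (Y \<omega>))) MX X)"
    then have A[measurable]: "A \<in> sets MX" by simp
    have [measurable]: "X -` A \<inter> space M \<in> sets M"
      by measurable
    have "emeasure (distr (density M (\<lambda>\<omega>. indicator B (Y \<omega>))) MX X) A
        = emeasure (density M (\<lambda>\<omega>. indicator B (Y \<omega>))) (X -` A \<inter> space M)"
      by (subst emeasure_distr) simp_all
    also have "\<dots> = (\<integral>\<^sup>+\<omega>. indicator B (Y \<omega>) * indicator (X -` A \<inter> space M) \<omega> \<partial>M)"
      by (rule emeasure_density) measurable
    also have "\<dots> = (\<integral>\<^sup>+\<omega>. indicator {\<omega>\<in>space M. X \<omega> \<in> A \<and> Y \<omega> \<in> B} \<omega> \<partial>M)"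
      by (intro nn_integral_cong) (auto simp: indicator_def)
    also have "\<dots> = emeasure M {\<omega>\<in>space M. X \<omega> \<in> A \<and> Y \<omega> \<in> B}"
      by (rule nn_integral_indicator) measurable
    also have "\<dots> = ennreal (\<integral>x. indicator A x * measure (K x) B \<partial>distr M MX X)"
      unfolding emeasure_eq_measure law[OF A] ..
    also have "\<dots> = (\<integral>\<^sup>+x. ennreal (indicator A x * measure (K x) B) \<partial>distr M MX X)"
    proof (rule nn_integral_eq_integral[symmetric])
      show "integrable (distr M MX X) (\<lambda>x. indicator A x * measure (K x) B)"
        using K1 by (intro D.integrable_const_bound[where B=1]) (auto simp: indicator_def)
    qed simp
    also have "\<dots> = (\<integral>\<^sup>+x. ennreal (measure (K x) B) * indicator A x \<partial>distr M MX X)"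
      by (intro nn_integral_cong) (simp add: indicator_def)
    also have "\<dots> = emeasure (density (distr M MX X) (\<lambda>x. ennreal (measure (K x) B))) A"
      by (rule emeasure_density[symmetric]) simp_all
    finally show "emeasure (distr (density M (\<lambda>\<omega>. indicator B (Y \<omega>))) MX X) A = \<dots>" .
  qed simp
  then have "(\<integral>\<^sup>+x. g x \<partial>distr (density M (\<lambda>\<omega>. indicator B (Y \<omega>))) MX X)
      = (\<integral>\<^sup>+x. g x \<partial>density (distr M MX X) (\<lambda>x. ennreal (measure (K x) B)))"
    by simp
  then show ?thesis
    by (simp add: nn_integral_distr nn_integral_density)
qed

lemma measurable_fst_obs_space:
  "fst \<in> obs_space m \<rightarrow>\<^sub>M borel_on (outcomes m)"
  unfolding obs_space_def
  by (rule measurable_restrict_space3[OF borel_measurable_continuous_onI])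
    (auto intro: continuous_on_fst continuous_on_id)

lemma measurable_snd_obs_space:
  "snd \<in> obs_space m \<rightarrow>\<^sub>M borel_on (covariates m)"
  unfolding obs_space_def
  by (rule measurable_restrict_space3[OF borel_measurable_continuous_onI])
    (auto intro: continuous_on_snd continuous_on_id)

lemma space_obs_space: "space (obs_space m) = outcomes m \<times> covariates m"
  by (simp add: obs_space_def)

text \<open>The density \<open>g x y\<close> at \<open>z = (y, x)\<close>, written as a finite sum over outcomes so that only
  measurability in the covariate is required.\<close>

definition eval_obs ::
  "('th, 'y, 'x, 'u) model \<Rightarrow> ('x \<Rightarrow> 'y \<Rightarrow> ennreal) \<Rightarrow> 'y \<times> 'x \<Rightarrow> ennreal" where
  "eval_obs m g z = (\<Sum>y\<in>outcomes m. indicator {y} (fst z) * g (snd z) y)"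

lemma eval_obs_eq:
  fixes m :: "('th, 'y::euclidean_space, 'x::euclidean_space, 'u) model"
  assumes "finite (outcomes m)" and "z \<in> space (obs_space m)"
  shows "eval_obs m g z = g (snd z) (fst z)"
  unfolding eval_obs_def
  by (subst sum.remove[of _ "fst z"]) (use assms in \<open>auto simp: space_obs_space intro!: sum.neutral\<close>)

lemma measurable_eval_obs:
  fixes m :: "('th, 'y::euclidean_space, 'x::euclidean_space, 'u) model"
  assumes "finite (outcomes m)"
    and g: "\<And>y. y \<in> outcomes m \<Longrightarrow>
      (\<lambda>(w, x). g w x y) \<in> borel_measurable (N \<Otimes>\<^sub>M borel_on (covariates m))"
  shows "(\<lambda>(w, z). eval_obs m (g w) z) \<in> borel_measurable (N \<Otimes>\<^sub>M obs_space m)"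
proof -
  have "(\<lambda>wz. indicator {y} (fst (snd wz)) * g (fst wz) (snd (snd wz)) y)
      \<in> borel_measurable (N \<Otimes>\<^sub>M obs_space m)" if y: "y \<in> outcomes m" for y
  proof (rule borel_measurable_times_ennreal)
    have "(\<lambda>wz. (fst wz, snd (snd wz))) \<in> N \<Otimes>\<^sub>M obs_space m \<rightarrow>\<^sub>M N \<Otimes>\<^sub>M borel_on (covariates m)"
      by (intro measurable_Pair measurable_fst measurable_compose[OF measurable_snd measurable_snd_obs_space])
    from measurable_compose[OF this g[OF y]]
    show "(\<lambda>wz. g (fst wz) (snd (snd wz)) y) \<in> borel_measurable (N \<Otimes>\<^sub>M obs_space m)"
      by simp
    have "(\<lambda>wz. fst (snd wz)) \<in> N \<Otimes>\<^sub>M obs_space m \<rightarrow>\<^sub>M borel_on (outcomes m)"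
      by (intro measurable_compose[OF measurable_snd measurable_fst_obs_space])
    moreover have "indicator {y} \<in> borel_measurable (borel_on (outcomes m))"
      using y assms(1) by (intro borel_measurable_indicator) (simp add: sets_borel_on_finite)
    ultimately show "(\<lambda>wz. indicator {y} (fst (snd wz)) :: ennreal) \<in> borel_measurable (N \<Otimes>\<^sub>M obs_space m)"
      by (rule measurable_compose)
  qed
  then show ?thesis
    unfolding eval_obs_def split_beta by (intro borel_measurable_sum)
qed

text \<open>Conditioning on the covariate turns the integral into the mean of a finite sum weighted
  by the masses of \<open>K x\<close>. These masses form a core element at every \<open>x\<close>,
  so \<open>le\<close> bounds the integrand pointwise.\<close>

lemma nn_integral_eval_obs_le_one:
  fixes m :: "('th, 'y::euclidean_space, 'x::euclidean_space, 'u) model"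
  assumes fin: "finite (outcomes m)"
    and M: "prob_space M" "sets M = sets (obs_space m)"
    and law: "cond_law M (borel_on (covariates m)) snd (borel_on (outcomes m)) fst K"
    and core: "\<And>x. x \<in> covariates m \<Longrightarrow> K x \<in> core_dists m \<theta> x"
    and g: "\<And>y. y \<in> outcomes m \<Longrightarrow> (\<lambda>x. g x y) \<in> borel_measurable (borel_on (covariates m))"
    and le: "\<And>x q. x \<in> covariates m \<Longrightarrow> q \<in> core_pmfs m \<theta> x \<Longrightarrow>
      (\<Sum>y\<in>outcomes m. ennreal (q y) * g x y) \<le> 1"
  shows "(\<integral>\<^sup>+z. eval_obs m g z \<partial>M) \<le> 1"
proof -
  let ?D = "distr M (borel_on (covariates m)) snd"
  have X: "snd \<in> M \<rightarrow>\<^sub>M borel_on (covariates m)" and Y: "fst \<in> M \<rightarrow>\<^sub>M borel_on (outcomes m)"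
    using measurable_fst_obs_space[of m] measurable_snd_obs_space[of m]
    by (simp_all add: measurable_cong_sets[OF M(2) refl])
  have B: "{y} \<in> sets (borel_on (outcomes m))" if "y \<in> outcomes m" for y
    using that by (simp add: sets_borel_on_finite[OF fin])
  have K: "K \<in> borel_on (covariates m) \<rightarrow>\<^sub>M prob_algebra (borel_on (outcomes m))"
    using law by (simp add: cond_law_def)
  interpret D: prob_space ?D
    by (rule prob_space.prob_space_distr[OF M(1) X])
  have "(\<integral>\<^sup>+z. eval_obs m g z \<partial>M)
      = (\<Sum>y\<in>outcomes m. \<integral>\<^sup>+z. indicator {y} (fst z) * g (snd z) y \<partial>M)"
    unfolding eval_obs_def
    by (intro nn_integral_sum borel_measurable_times_ennreal measurable_compose[OF X g]
        measurable_compose[OF Y borel_measurable_indicator[OF B]])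
  also have "\<dots> = (\<Sum>y\<in>outcomes m. \<integral>\<^sup>+x. ennreal (measure (K x) {y}) * g x y \<partial>?D)"
    by (intro sum.cong refl nn_integral_cond_law[OF law M(1) X Y B g])
  also have "\<dots> = (\<integral>\<^sup>+x. (\<Sum>y\<in>outcomes m. ennreal (measure (K x) {y}) * g x y) \<partial>?D)"
    using B g by (intro nn_integral_sum[symmetric] borel_measurable_times_ennreal measurable_compose[OF _ measurable_ennreal])
      (simp_all add: measurable_compose[OF K measurable_measure_prob_algebra])
  also have "\<dots> \<le> (\<integral>\<^sup>+x. 1 \<partial>?D)"
  proof (rule nn_integral_mono)
    fix x assume "x \<in> space ?D"
    then have x: "x \<in> covariates m" by simp
    then have "(\<lambda>y. measure (K x) {y}) \<in> core_pmfs m \<theta> x"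
      using core by (auto simp: core_pmfs_def)
    from le[OF x this] show "(\<Sum>y\<in>outcomes m. ennreal (measure (K x) {y}) * g x y) \<le> 1" .
  qed
  also have "\<dots> = 1"
    using D.emeasure_space_1 by simp
  finally show ?thesis .
qed

section \<open>The split statistic and its bound by the ratio at a fixed null parameter\<close>

lemma ennreal_divide_antimono:
  assumes "0 \<le> a" and "0 \<le> c" and "c \<le> b"
  shows "ennreal a / ennreal b \<le> ennreal a / ennreal c"
proof (cases "c = 0")
  case True
  then show ?thesis
    using assms by (cases "a = 0") (simp_all add: divide_ennreal_def ennreal_mult_top)
next
  case False
  then show ?thesis
    using assms by (simp add: divide_ennreal divide_left_mono)
qed

text \<open>Zero denominators are included. All factors \<open>ennreal (q i)\<close> are finite, so
  no inverse is 0, and inverting the product factor by factor never meets the form 0 times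
  infinity.\<close>

lemma ennreal_prod_divide:
  assumes "\<And>i. i \<in> D \<Longrightarrow> 0 \<le> p i" and "\<And>i. i \<in> D \<Longrightarrow> 0 \<le> q i"
  shows "ennreal (\<Prod>i\<in>D. p i) / ennreal (\<Prod>i\<in>D. q i) = (\<Prod>i\<in>D. ennreal (p i) / ennreal (q i))"
proof -
  have "inverse (\<Prod>i\<in>D. ennreal (q i)) = (\<Prod>i\<in>D. inverse (ennreal (q i)))"
  proof (induction D rule: infinite_finite_induct)
    case (insert i D)
    have "(\<Prod>i\<in>D. ennreal (q i)) < \<top>"
      by (induction D rule: infinite_finite_induct) (auto simp: ennreal_mult_less_top)
    then show ?case
      using insert by (simp add: ennreal_inverse_mult)
  qed auto
  then show ?thesis
    using assms by (simp add: divide_ennreal_def prod.distrib flip: prod_ennreal)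
qed

lemma valid_fit_dens:
  fixes m :: "('th, 'y::euclidean_space, 'x::euclidean_space, 'u::euclidean_space) model"
  assumes "valid_model m" and "valid_fit m n \<Theta>0 D0 D1 f"
    and "w \<in> space (sample_space m D1)" and "x \<in> covariates m"
  shows "\<And>y. y \<in> outcomes m \<Longrightarrow> 0 < dens f w x y" and "sum (dens f w x) (outcomes m) = 1"
    and "\<And>\<theta>. \<theta> \<in> \<Theta>0 \<Longrightarrow>
      \<exists>!q. is_arg_min (lfp_objective m (dens f w x)) (\<lambda>q. q \<in> core_pmfs m \<theta> x) q"
proof -
  have fin: "finite (outcomes m)"
    using assms(1) by (simp add: valid_model_def)
  have *: "dens f w x \<in> core_pmfs m (est1 f w) x \<and> (\<forall>y\<in>outcomes m. 0 < dens f w x y) \<and>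
      (\<forall>\<theta>\<in>\<Theta>0. \<exists>!q. is_arg_min (lfp_objective m (dens f w x)) (\<lambda>q. q \<in> core_pmfs m \<theta> x) q)"
    using assms(2-4) unfolding valid_fit_def by blast
  show "0 < dens f w x y" if "y \<in> outcomes m" for y
    using * that by blast
  show "sum (dens f w x) (outcomes m) = 1"
    using * by (simp add: core_pmfs_iff[OF fin])
  show "\<exists>!q. is_arg_min (lfp_objective m (dens f w x)) (\<lambda>q. q \<in> core_pmfs m \<theta> x) q"
    if "\<theta> \<in> \<Theta>0" for \<theta>
    using * that by blast
qed

lemma lfp_density_nonneg:
  fixes m :: "('th, 'y::euclidean_space, 'x, 'u) model"
  assumes fin: "finite (outcomes m)"
    and ex: "\<exists>!q. is_arg_min (lfp_objective m (p x)) (\<lambda>q. q \<in> core_pmfs m \<theta> x) q"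
  shows "0 \<le> lfp_density m p \<theta> x y"
proof -
  have "is_arg_min (lfp_objective m (p x)) (\<lambda>q. q \<in> core_pmfs m \<theta> x) (lfp_density m p \<theta> x)"
    unfolding lfp_density_def arg_min_on_def arg_min_def using ex by (metis someI_ex)
  then show ?thesis
    by (simp add: is_arg_min_def core_pmfs_iff[OF fin])
qed

text \<open>The estimation subsample \<open>w\<close> is an argument of its own, so that it can be
  held fixed while the evaluation observations are integrated out. Values in \<open>ennreal\<close>
  give infinity when only the denominator vanishes.\<close>

definition lfp_ratio ::
  "('th, 'y::euclidean_space, 'x, 'u) model \<Rightarrow> ('th, 'y, 'x) fit \<Rightarrow> 'th \<Rightarrow>
    (nat \<Rightarrow> 'y \<times> 'x) \<Rightarrow> 'x \<Rightarrow> 'y \<Rightarrow> ennreal" where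
  "lfp_ratio m f \<theta> w x y = ennreal (dens f w x y) / ennreal (lfp_density m (dens f w) \<theta> x y)"

lemma measurable_lfp_ratio:
  fixes m :: "('th, 'y::euclidean_space, 'x::euclidean_space, 'u::euclidean_space) model"
  assumes "valid_fit m n \<Theta>0 D0 D1 f" and "\<theta> \<in> \<Theta>0" and "y \<in> outcomes m"
  shows "(\<lambda>(w, x). lfp_ratio m f \<theta> w x y)
    \<in> borel_measurable (sample_space m D1 \<Otimes>\<^sub>M borel_on (covariates m))"
proof -
  have "\<forall>y\<in>outcomes m.
      (\<lambda>(w, x). dens f w x y)
        \<in> borel_measurable (sample_space m D1 \<Otimes>\<^sub>M borel_on (covariates m)) \<and>
      (\<forall>\<theta>\<in>\<Theta>0. (\<lambda>(w, x). lfp_density m (dens f w) \<theta> x y)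
        \<in> borel_measurable (sample_space m D1 \<Otimes>\<^sub>M borel_on (covariates m)))"
    using assms(1) unfolding valid_fit_def by blast
  then have "(\<lambda>wx. dens f (fst wx) (snd wx) y)
      \<in> borel_measurable (sample_space m D1 \<Otimes>\<^sub>M borel_on (covariates m))"
    "(\<lambda>wx. lfp_density m (dens f (fst wx)) \<theta> (snd wx) y)
      \<in> borel_measurable (sample_space m D1 \<Otimes>\<^sub>M borel_on (covariates m))"
    using assms(2,3) by (simp_all add: split_beta')
  then show ?thesis
    unfolding lfp_ratio_def split_beta'
    by (intro borel_measurable_divide_ennreal measurable_compose[OF _ measurable_ennreal])
qed

lemma measurable_prod_eval_obs:
  fixes m :: "('th, 'y::euclidean_space, 'x::euclidean_space, 'u::euclidean_space) model"
  assumes "finite (outcomes m)" and "D0 \<subseteq> I" and "D1 \<subseteq> I"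
    and g: "\<And>y. y \<in> outcomes m \<Longrightarrow> (\<lambda>(w, x). g w x y)
      \<in> borel_measurable (sample_space m D1 \<Otimes>\<^sub>M borel_on (covariates m))"
  shows "(\<lambda>z. \<Prod>i\<in>D0. eval_obs m (g (restrict z D1)) (z i)) \<in> borel_measurable (sample_space m I)"
proof (rule borel_measurable_prod_ennreal)
  fix i assume "i \<in> D0"
  then have "(\<lambda>z. (restrict z D1, z i)) \<in> sample_space m I \<rightarrow>\<^sub>M sample_space m D1 \<Otimes>\<^sub>M obs_space m"
    using assms(2,3) unfolding sample_space_def
    by (intro measurable_Pair measurable_restrict_subset measurable_component_singleton) auto
  from measurable_compose[OF this measurable_eval_obs[OF assms(1) g]]
  show "(\<lambda>z. eval_obs m (g (restrict z D1)) (z i)) \<in> borel_measurable (sample_space m I)"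
    by simp
qed

lemma sample_space_component:
  fixes m :: "('th, 'y::euclidean_space, 'x::euclidean_space, 'u::euclidean_space) model"
  assumes "z \<in> space (sample_space m I)" and "i \<in> I"
  shows "z i \<in> space (obs_space m)"
  using assms by (auto simp: sample_space_def space_PiM)

lemma sample_space_restrict:
  fixes m :: "('th, 'y::euclidean_space, 'x::euclidean_space, 'u::euclidean_space) model"
  assumes "z \<in> space (sample_space m I)" and "D \<subseteq> I"
  shows "restrict z D \<in> space (sample_space m D)"
  using assms by (auto simp: sample_space_def space_PiM)

text \<open>\<open>est0\<close> maximises the null likelihood, so putting \<open>\<theta>\<close> in
  its place can only lower the denominator. This removes the one choice that depends on the
  evaluation subsample, and what remains is a product over that subsample with densities fixed by
  \<open>restrict z D1\<close>.\<close>

lemma split_LR_le_prod_ratio: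
  fixes m :: "('th, 'y::euclidean_space, 'x::euclidean_space, 'u::euclidean_space) model"
  assumes valid: "valid_model m" and fit: "valid_fit m n \<Theta>0 D0 D1 f" and \<theta>: "\<theta> \<in> \<Theta>0"
    and D: "D0 \<subseteq> {1..n}" "D1 \<subseteq> {1..n}" and z: "z \<in> space (sample_space m {1..n})"
  shows "split_LR m D0 D1 f z \<le> (\<Prod>i\<in>D0. eval_obs m (lfp_ratio m f \<theta> (restrict z D1)) (z i))"
proof -
  have fin: "finite (outcomes m)"
    using valid by (simp add: valid_model_def)
  let ?w = "restrict z D1"
  let ?q = "lfp_density m (dens f ?w) \<theta>"
  have w: "?w \<in> space (sample_space m D1)"
    using z D by (intro sample_space_restrict)
  have zi: "z i \<in> space (obs_space m)" if "i \<in> D0" for i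
    using z that D by (intro sample_space_component[of z m "{1..n}"]) auto
  have p0: "0 \<le> dens f ?w (snd (z i)) (fst (z i))" if "i \<in> D0" for i
    using valid_fit_dens(1)[OF valid fit w] zi[OF that] by (force simp: space_obs_space intro: less_imp_le)
  have q0: "0 \<le> ?q (snd (z i)) (fst (z i))" if "i \<in> D0" for i
  proof -
    have "snd (z i) \<in> covariates m"
      using zi[OF that] by (auto simp: space_obs_space)
    then show ?thesis
      by (intro lfp_density_nonneg[OF fin] valid_fit_dens(3)[OF valid fit w _ \<theta>])
  qed
  have "is_arg_max (\<lambda>\<theta>. null_likelihood m D0 D1 f \<theta> z) (\<lambda>\<theta>. \<theta> \<in> \<Theta>0) (est0 f z)"
    using fit z by (simp add: valid_fit_def)
  then have "null_likelihood m D0 D1 f \<theta> z \<le> null_likelihood m D0 D1 f (est0 f z) z"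
    using \<theta> by (auto simp: is_arg_max_def not_less)
  then have "split_LR m D0 D1 f z
      \<le> ennreal (likelihood D0 (dens f ?w) z) / ennreal (null_likelihood m D0 D1 f \<theta> z)"
    unfolding split_LR_def using p0 q0
    by (intro ennreal_divide_antimono) (auto simp: likelihood_def null_likelihood_def intro!: prod_nonneg)
  also have "\<dots> = (\<Prod>i\<in>D0. ennreal (dens f ?w (snd (z i)) (fst (z i))) / ennreal (?q (snd (z i)) (fst (z i))))"
    unfolding likelihood_def null_likelihood_def using p0 q0 by (rule ennreal_prod_divide)
  also have "\<dots> = (\<Prod>i\<in>D0. eval_obs m (lfp_ratio m f \<theta> ?w) (z i))"
    by (intro prod.cong refl) (simp add: eval_obs_eq[OF fin zi] lfp_ratio_def)
  finally show ?thesis .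
qed

text \<open>The densities are measurable in subsample and covariate for each fixed outcome. The
  numerator is therefore rewritten through \<open>eval_obs\<close>, while the maximised denominator
  is measurable by \<open>valid_fit\<close>.\<close>

lemma measurable_split_LR:
  fixes m :: "('th, 'y::euclidean_space, 'x::euclidean_space, 'u::euclidean_space) model"
  assumes valid: "valid_model m" and fit: "valid_fit m n \<Theta>0 D0 D1 f"
    and D: "D0 \<subseteq> {1..n}" "D1 \<subseteq> {1..n}"
  shows "split_LR m D0 D1 f \<in> borel_measurable (sample_space m {1..n})"
proof -
  have fin: "finite (outcomes m)"
    using valid by (simp add: valid_model_def)
  let ?p = "\<lambda>w x y. ennreal (dens f w x y)"
  have "(\<lambda>z. (\<Prod>i\<in>D0. eval_obs m (?p (restrict z D1)) (z i)) / ennreal (null_likelihood m D0 D1 f (est0 f z) z))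
      \<in> borel_measurable (sample_space m {1..n})"
  proof (intro borel_measurable_divide_ennreal measurable_prod_eval_obs fin D)
    show "(\<lambda>(w, x). ?p w x y) \<in> borel_measurable (sample_space m D1 \<Otimes>\<^sub>M borel_on (covariates m))"
      if "y \<in> outcomes m" for y
    proof -
      have "(\<lambda>(w, x). dens f w x y) \<in> borel_measurable (sample_space m D1 \<Otimes>\<^sub>M borel_on (covariates m))"
        using fit that by (simp add: valid_fit_def)
      from measurable_compose[OF this measurable_ennreal] show ?thesis
        by (simp add: split_beta')
    qed
    have "(\<lambda>z. null_likelihood m D0 D1 f (est0 f z) z) \<in> borel_measurable (sample_space m {1..n})"
      using fit by (simp add: valid_fit_def)
    from measurable_compose[OF this measurable_ennreal]
    show "(\<lambda>z. ennreal (null_likelihood m D0 D1 f (est0 f z) z)) \<in> borel_measurable (sample_space m {1..n})" .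
  qed
  moreover have "split_LR m D0 D1 f z
      = (\<Prod>i\<in>D0. eval_obs m (?p (restrict z D1)) (z i)) / ennreal (null_likelihood m D0 D1 f (est0 f z) z)"
    if z: "z \<in> space (sample_space m {1..n})" for z
  proof -
    have w: "restrict z D1 \<in> space (sample_space m D1)"
      using z D by (intro sample_space_restrict)
    have zi: "z i \<in> space (obs_space m)" if "i \<in> D0" for i
      using z that D by (intro sample_space_component[of z m "{1..n}"]) auto
    have "ennreal (likelihood D0 (dens f (restrict z D1)) z)
        = (\<Prod>i\<in>D0. ennreal (dens f (restrict z D1) (snd (z i)) (fst (z i))))"
      unfolding likelihood_def
    proof (rule prod_ennreal[symmetric])
      fix i assume "i \<in> D0"
      then show "0 \<le> dens f (restrict z D1) (snd (z i)) (fst (z i))"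
        using valid_fit_dens(1)[OF valid fit w] zi by (force simp: space_obs_space intro: less_imp_le)
    qed
    also have "\<dots> = (\<Prod>i\<in>D0. eval_obs m (?p (restrict z D1)) (z i))"
      by (intro prod.cong refl) (simp add: eval_obs_eq[OF fin zi])
    finally show ?thesis
      by (simp add: split_LR_def)
  qed
  ultimately show ?thesis
    by (subst measurable_cong) auto
qed

section \<open>The mean of the split statistic and coverage\<close>

text \<open>After the bound at the true \<open>\<theta>\<close>, Tonelli's theorem integrates the
  evaluation coordinates first. For fixed \<open>w\<close> the integrand is a product over distinct
  coordinates, each factor integrating to at most one under the law of its own observation.\<close>

lemma nn_integral_split_LR_le_one:
  fixes m :: "('th, 'y::euclidean_space, 'x::euclidean_space, 'u::euclidean_space) model"
  assumes valid: "valid_model m" and fit: "valid_fit m n \<Theta>0 D0 D1 f"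
    and \<theta>: "\<theta> \<in> \<Theta>0" "\<theta> \<in> params m"
    and D: "D0 \<union> D1 = {1..n}" "D0 \<inter> D1 = {}" and P: "P \<in> dgps m n \<theta>"
  shows "(\<integral>\<^sup>+z. split_LR m D0 D1 f z \<partial>P) \<le> 1"
proof -
  have fin: "finite (outcomes m)"
    using valid by (simp add: valid_model_def)
  have fin_D: "finite D0" "finite D1"
    using D(1) finite_atLeastAtMost[of 1 n] by (metis finite_Un)+
  have sub: "D0 \<subseteq> {1..n}" "D1 \<subseteq> {1..n}" and un: "D1 \<union> D0 = {1..n}" and dis: "D1 \<inter> D0 = {}"
    using D by auto
  obtain Pi where P_eq: "P = PiM {1..n} Pi"
    and "\<forall>i\<in>{1..n}. \<exists>K. prob_space (Pi i) \<and> sets (Pi i) = sets (obs_space m) \<and>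
      cond_law (Pi i) (borel_on (covariates m)) snd (borel_on (outcomes m)) fst K \<and>
      (\<forall>x\<in>covariates m. K x \<in> core_dists m \<theta> x)"
    using P unfolding dgps_def by blast
  from bchoice[OF this(2)] obtain K where
    Pi: "\<And>i. i \<in> {1..n} \<Longrightarrow> prob_space (Pi i) \<and> sets (Pi i) = sets (obs_space m) \<and>
      cond_law (Pi i) (borel_on (covariates m)) snd (borel_on (outcomes m)) fst (K i) \<and>
      (\<forall>x\<in>covariates m. K i x \<in> core_dists m \<theta> x)"
    by blast
  \<comment> \<open>\<open>product_sigma_finite\<close> concerns all indices, so the family is
    completed by an arbitrary probability measure outside \<open>{1..n}\<close>.\<close>
  define M where "M i = (if i \<in> {1..n} then Pi i else return (count_space UNIV) undefined)" for i
  have prob_M: "prob_space (M i)" for i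
    using Pi[of i] by (cases "i \<in> {1..n}") (simp_all add: M_def prob_space_return)
  interpret product_sigma_finite M
    by (simp add: product_sigma_finite_def prob_M prob_space_imp_sigma_finite)
  have P_M: "P = PiM {1..n} M"
    unfolding P_eq by (rule PiM_cong) (auto simp: M_def)
  have sets_M: "sets (M i) = sets (obs_space m)" if "i \<in> {1..n}" for i
    using Pi[OF that] that by (simp add: M_def)
  have sets_PiM: "sets (PiM D M) = sets (sample_space m D)" if "D \<subseteq> {1..n}" for D
    unfolding sample_space_def using that sets_M by (intro sets_PiM_cong) auto
  have space_PiM': "space (PiM D M) = space (sample_space m D)" if "D \<subseteq> {1..n}" for D
    by (rule sets_eq_imp_space_eq[OF sets_PiM[OF that]])
  let ?R = "\<lambda>w z. eval_obs m (lfp_ratio m f \<theta> w) z"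
  have g: "(\<lambda>(w, x). lfp_ratio m f \<theta> w x y)
      \<in> borel_measurable (sample_space m D1 \<Otimes>\<^sub>M borel_on (covariates m))" if "y \<in> outcomes m" for y
    by (rule measurable_lfp_ratio[OF fit \<theta>(1) that])
  have R_le: "(\<integral>\<^sup>+z. ?R w z \<partial>M i) \<le> 1"
    if w: "w \<in> space (sample_space m D1)" and i: "i \<in> {1..n}" for w i
  proof (rule nn_integral_eval_obs_le_one[OF fin])
    show "prob_space (M i)" "sets (M i) = sets (obs_space m)"
      "cond_law (M i) (borel_on (covariates m)) snd (borel_on (outcomes m)) fst (K i)"
      "\<And>x. x \<in> covariates m \<Longrightarrow> K i x \<in> core_dists m \<theta> x"
      using Pi[OF i] i by (auto simp: M_def)
    show "(\<lambda>x. lfp_ratio m f \<theta> w x y) \<in> borel_measurable (borel_on (covariates m))"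
      if "y \<in> outcomes m" for y
      using measurable_compose[OF measurable_Pair1'[OF w] g[OF that]] by simp
    show "(\<Sum>y\<in>outcomes m. ennreal (q y) * lfp_ratio m f \<theta> w x y) \<le> 1"
      if "x \<in> covariates m" "q \<in> core_pmfs m \<theta> x" for x q
      unfolding lfp_ratio_def
      by (rule core_pmfs_ratio_le_one[OF valid \<theta>(2) that(1)
          valid_fit_dens(1,2)[OF valid fit w that(1)] valid_fit_dens(3)[OF valid fit w that(1) \<theta>(1)] _ that(2)])
        (simp_all add: lfp_density_def)
  qed
  have R_meas: "(\<lambda>z. ?R w z) \<in> borel_measurable (M i)"
    if w: "w \<in> space (sample_space m D1)" and i: "i \<in> {1..n}" for w i
    using measurable_compose[OF measurable_Pair1'[OF w] measurable_eval_obs[OF fin g]]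
    by (simp add: measurable_cong_sets[OF sets_M[OF i] refl])
  have "(\<integral>\<^sup>+z. split_LR m D0 D1 f z \<partial>P) \<le> (\<integral>\<^sup>+z. (\<Prod>i\<in>D0. ?R (restrict z D1) (z i)) \<partial>P)"
    using split_LR_le_prod_ratio[OF valid fit \<theta>(1) sub] space_PiM'[of "{1..n}"]
    by (intro nn_integral_mono) (simp add: P_M)
  also have "\<dots> = (\<integral>\<^sup>+z. (\<Prod>i\<in>D0. ?R (restrict z D1) (z i)) \<partial>PiM (D1 \<union> D0) M)"
    by (simp add: P_M un)
  \<comment> \<open>With \<open>D1\<close> as the first block, the outer integral runs over the
    estimation subsample and the inner one over the evaluation subsample.\<close>
  also have "\<dots> = (\<integral>\<^sup>+w. (\<integral>\<^sup>+z. (\<Prod>i\<in>D0. ?R (restrict (merge D1 D0 (w, z)) D1) (merge D1 D0 (w, z) i))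
      \<partial>PiM D0 M) \<partial>PiM D1 M)"
  proof (rule product_nn_integral_fold[OF dis fin_D(2,1)])
    have "sets (PiM (D1 \<union> D0) M) = sets (sample_space m {1..n})"
      unfolding un by (rule sets_PiM) simp
    then show "(\<lambda>z. \<Prod>i\<in>D0. ?R (restrict z D1) (z i)) \<in> borel_measurable (PiM (D1 \<union> D0) M)"
      using measurable_prod_eval_obs[OF fin sub g] by (simp cong: measurable_cong_sets)
  qed
  also have "\<dots> \<le> (\<integral>\<^sup>+w. 1 \<partial>PiM D1 M)"
  proof (rule nn_integral_mono)
    fix w assume "w \<in> space (PiM D1 M)"
    then have w: "w \<in> space (sample_space m D1)"
      using space_PiM'[OF sub(2)] by simp
    \<comment> \<open>Points of a product space are extensional, so restricting the merged sample to
      \<open>D1\<close> recovers \<open>w\<close>, and the densities are constant in the inner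
      integral.\<close>
    then have "restrict w D1 = w"
      by (auto simp: sample_space_def space_PiM PiE_def extensional_restrict)
    then have "(\<integral>\<^sup>+z. (\<Prod>i\<in>D0. ?R (restrict (merge D1 D0 (w, z)) D1) (merge D1 D0 (w, z) i)) \<partial>PiM D0 M)
        = (\<integral>\<^sup>+z. (\<Prod>i\<in>D0. ?R w (z i)) \<partial>PiM D0 M)"
      using dis by (intro nn_integral_cong prod.cong refl) auto
    also have "\<dots> = (\<Prod>i\<in>D0. \<integral>\<^sup>+z. ?R w z \<partial>M i)"
      using sub by (intro product_nn_integral_prod fin_D R_meas w) auto
    also have "\<dots> \<le> 1"
      using sub by (intro prod_le_1) (auto intro!: R_le w)
    finally show "(\<integral>\<^sup>+z. (\<Prod>i\<in>D0. ?R (restrict (merge D1 D0 (w, z)) D1) (merge D1 D0 (w, z) i)) \<partial>PiM D0 M) \<le> 1" .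
  qed
  also have "\<dots> = 1"
    using prob_space.emeasure_space_1[OF prob_space_PiM[OF prob_M]] by simp
  finally show ?thesis .
qed

theorem corollary1:
  fixes m :: "('th, real ^ 'dy, real ^ 'dx, real ^ 'du) model"
    and \<phi> :: "'th \<Rightarrow> real ^ 'dphi"
    and \<alpha> :: real and n :: nat and D0 D1 :: "nat set"
    and f fswap :: "real ^ 'dphi \<Rightarrow> ('th, real ^ 'dy, real ^ 'dx) fit"
  assumes "valid_model m"
    and "0 < \<alpha>" and "\<alpha> < 1"
    and "D0 \<union> D1 = {1..n}" and "D0 \<inter> D1 = {}"
    and "\<forall>\<phi>s \<in> \<phi> ` params m. valid_fit m n (null_params m \<phi> \<phi>s) D0 D1 (f \<phi>s)"
    and "\<forall>\<phi>s \<in> \<phi> ` params m. valid_fit m n (null_params m \<phi> \<phi>s) D1 D0 (fswap \<phi>s)"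
  shows "ennreal (1 - \<alpha>) \<le>
    (INF (\<phi>s, P) \<in> {(\<phi>s, P) \<in> dgp_pairs m \<phi> n.
                      \<exists>\<theta> \<in> null_params m \<phi> \<phi>s. sampling_scheme m n \<theta> P}.
       emeasure P {z \<in> space P. \<phi>s \<in> confidence_set m D0 D1 f fswap \<alpha> z})"
proof (rule INF_greatest, clarify)
  fix \<phi>s P
  assume "(\<phi>s, P) \<in> dgp_pairs m \<phi> n"
  then obtain \<theta> where \<theta>: "\<theta> \<in> params m" "\<phi> \<theta> = \<phi>s" and P: "P \<in> dgps m n \<theta>"
    by (auto simp: dgp_pairs_def)
  have \<theta>0: "\<theta> \<in> null_params m \<phi> \<phi>s"
    using \<theta> by (simp add: null_params_def)
  have fit: "valid_fit m n (null_params m \<phi> \<phi>s) D0 D1 (f \<phi>s)"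
    "valid_fit m n (null_params m \<phi> \<phi>s) D1 D0 (fswap \<phi>s)"
    using assms(6,7) \<theta> by auto
  have D': "D1 \<union> D0 = {1..n}" "D1 \<inter> D0 = {}" and sub: "D0 \<subseteq> {1..n}" "D1 \<subseteq> {1..n}"
    using assms(4,5) by auto
  interpret prob_space P
    using P by (simp add: dgps_def)
  have sets: "sets P = sets (sample_space m {1..n})"
    using P by (simp add: dgps_def)
  let ?T = "split_LR m D0 D1 (f \<phi>s)" and ?T' = "split_LR m D1 D0 (fswap \<phi>s)"
  let ?S = "crossfit_LR m D0 D1 (f \<phi>s) (fswap \<phi>s)"
  have T[measurable]: "?T \<in> borel_measurable P" "?T' \<in> borel_measurable P"
    using measurable_split_LR[OF assms(1) fit(1) sub] measurable_split_LR[OF assms(1) fit(2) sub(2,1)]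
    by (simp_all add: measurable_cong_sets[OF sets refl])
  have S[measurable]: "?S \<in> borel_measurable P"
    unfolding crossfit_LR_def by measurable
  \<comment> \<open>Linearity suffices here, although the two split statistics share the sample and
    may be dependent.\<close>
  have "(\<integral>\<^sup>+z. ?S z \<partial>P) = ((\<integral>\<^sup>+z. ?T z \<partial>P) + (\<integral>\<^sup>+z. ?T' z \<partial>P)) / 2"
    unfolding crossfit_LR_def by (simp add: nn_integral_divide nn_integral_add)
  also have "\<dots> \<le> (1 + 1) / 2"
    using nn_integral_split_LR_le_one[OF assms(1) fit(1) \<theta>0 \<theta>(1) assms(4,5) P]
      nn_integral_split_LR_le_one[OF assms(1) fit(2) \<theta>0 \<theta>(1) D' P]
    by (intro divide_right_mono_ennreal add_mono)
  also have "(1 + 1) / 2 = (1 :: ennreal)"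
    by (simp add: ennreal_divide_self)
  finally have ES: "(\<integral>\<^sup>+z. ?S z \<partial>P) \<le> 1" .
  let ?A = "{z \<in> space P. ennreal (1 / \<alpha>) < ?S z}"
  have A: "?A \<in> events" by measurable
  \<comment> \<open>The threshold 1 / \<alpha> is rewritten as 1 \<le> \<alpha> S, the
    multiplicative form in which Markov's inequality is applied.\<close>
  have "emeasure P ?A \<le> emeasure P {z \<in> space P. 1 \<le> ennreal \<alpha> * ?S z}"
  proof (rule emeasure_mono)
    show "?A \<subseteq> {z \<in> space P. 1 \<le> ennreal \<alpha> * ?S z}"
    proof safe
      fix z assume "ennreal (1 / \<alpha>) < ?S z"
      then have "ennreal \<alpha> * ennreal (1 / \<alpha>) \<le> ennreal \<alpha> * ?S z"
        by (intro mult_left_mono) auto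
      then show "1 \<le> ennreal \<alpha> * ?S z"
        using assms(2) by (simp flip: ennreal_mult)
    qed
  qed measurable
  also have "\<dots> \<le> ennreal \<alpha> * (\<integral>\<^sup>+z. ?S z * indicator (space P) z \<partial>P)"
    by (rule nn_integral_Markov_inequality) auto
  also have "\<dots> = ennreal \<alpha> * (\<integral>\<^sup>+z. ?S z \<partial>P)"
    by (intro arg_cong2[where f="(*)"] refl nn_integral_cong) simp
  also have "\<dots> \<le> ennreal \<alpha>"
    using mult_left_mono[OF ES, of "ennreal \<alpha>"] by simp
  finally have "prob ?A \<le> \<alpha>"
    using assms(2) by (simp add: emeasure_eq_measure)
  have "{z \<in> space P. \<phi>s \<in> confidence_set m D0 D1 f fswap \<alpha> z} = space P - ?A"
    by (auto simp: confidence_set_def not_less)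
  then have "emeasure P {z \<in> space P. \<phi>s \<in> confidence_set m D0 D1 f fswap \<alpha> z} = ennreal (1 - prob ?A)"
    using prob_compl[OF A] by (simp add: emeasure_eq_measure)
  with \<open>prob ?A \<le> \<alpha>\<close>
  show "ennreal (1 - \<alpha>) \<le> emeasure P {z \<in> space P. \<phi>s \<in> confidence_set m D0 D1 f fswap \<alpha> z}"
    by (simp add: ennreal_leI)
qed

end
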